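(* No finite set of moves suffices to connect the sets of maximal chains in all closed intervals of type $A$ crystal posets: there is no integer $d$ such that, for every type $A$ crystal poset $B(\lambda)$ and every closed interval $[u,v]$ in it, any two maximal chains of $[u,v]$ can be connected by a sequence of steps, each replacing the portion of a saturated chain between two of its elements $x<y$ with $\mathrm{rank}(y)-\mathrm{rank}(x)\le d$ by another saturated chain from $x$ to $y$. In particular, there are disconnected open intervals $(u,v)$ in type $A$ crystal posets of arbitrarily large rank.
   Context: A type $A$ crystal poset is the crystal $B(\lambda)$ of the irreducible highest weight $\mathfrak{sl}_n$-module $V(\lambda)$ for a partition $\lambda$ with fewer than $n$ parts, realized as the set of semistandard Young tableaux of shape $\lambda$ with entries in $\{1,\dots,n\}$, partially ordered by the transitive closure of $T\lessdot f_i(T)$, where $f_i$ is the crystal operator given by the signature rule: read the entries $i$ and $i+1$ of $T$ column by column from left to right, bottom to top within a column, write $+$ for $i$ and $-$ for $i+1$, repeatedly cancel adjacent pairs $-+$ to obtain $+^x-^y$; if $x>0$, $f_i(T)$ changes the $i$ corresponding to the rightmost uncancelled $+$ into $i+1$ (otherwise $f_i(T)=\mathbf 0$). The poset is graded; rank means the length of maximal chains. An open interval is disconnected if its Hasse diagram (equivalently its order complex) is disconnected. *)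

theory Defs
  imports Main
begin

text \<open>Posets are given by a relation \<open>le\<close> that holds only between elements of the poset, so that
  the carrier is \<open>{x. le x x}\<close>. Chains are sets; maximal chains are those of \<^theory>\<open>HOL.Zorn\<close>.\<close>

definition strict_less :: "('a \<Rightarrow> 'a \<Rightarrow> bool) \<Rightarrow> 'a \<Rightarrow> 'a \<Rightarrow> bool" where
  "strict_less le x y \<longleftrightarrow> le x y \<and> x \<noteq> y"

definition closed_interval :: "('a \<Rightarrow> 'a \<Rightarrow> bool) \<Rightarrow> 'a \<Rightarrow> 'a \<Rightarrow> 'a set" where
  "closed_interval le u v = {z. le u z \<and> le z v}"

definition open_interval :: "('a \<Rightarrow> 'a \<Rightarrow> bool) \<Rightarrow> 'a \<Rightarrow> 'a \<Rightarrow> 'a set" where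
  "open_interval le u v = {z. strict_less le u z \<and> strict_less le z v}"

text \<open>For \<open>x \<le> y\<close>, the saturated chains from \<open>x\<close> to \<open>y\<close> are the maximal chains of \<open>[x, y]\<close>.\<close>

definition saturated_chain :: "('a \<Rightarrow> 'a \<Rightarrow> bool) \<Rightarrow> 'a \<Rightarrow> 'a \<Rightarrow> 'a set \<Rightarrow> bool" where
  "saturated_chain le x y C \<longleftrightarrow> pred_on.maxchain (closed_interval le x y) le C"

text \<open>A chain with \<open>k + 1\<close> elements has length \<open>k\<close>. The posets considered here are finite and graded,
  so \<open>Max\<close> only selects the common length of all maximal chains.\<close>

definition poset_rank :: "('a \<Rightarrow> 'a \<Rightarrow> bool) \<Rightarrow> 'a set \<Rightarrow> nat" where
  "poset_rank le S = Max {card C - 1 | C. pred_on.maxchain S le C}"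

definition elem_rank :: "('a \<Rightarrow> 'a \<Rightarrow> bool) \<Rightarrow> 'a \<Rightarrow> nat" where
  "elem_rank le x = poset_rank le {z. le z x}"

definition chain_move :: "('a \<Rightarrow> 'a \<Rightarrow> bool) \<Rightarrow> int \<Rightarrow> 'a set \<Rightarrow> 'a set \<Rightarrow> bool" where
  "chain_move le d C C' \<longleftrightarrow>
    (\<exists>x\<in>C. \<exists>y\<in>C. \<exists>D. strict_less le x y \<and> int (elem_rank le y) - int (elem_rank le x) \<le> d \<and>
       saturated_chain le x y D \<and> C' = (C - closed_interval le x y) \<union> D)"

definition hasse_edge :: "('a \<Rightarrow> 'a \<Rightarrow> bool) \<Rightarrow> 'a set \<Rightarrow> 'a \<Rightarrow> 'a \<Rightarrow> bool" where
  "hasse_edge le S a b \<longleftrightarrow> a \<in> S \<and> b \<in> S \<and> strict_less le a b \<and> \<not> (\<exists>z\<in>S. strict_less le a z \<and> strict_less le z b)"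

definition hasse_disconnected :: "('a \<Rightarrow> 'a \<Rightarrow> bool) \<Rightarrow> 'a set \<Rightarrow> bool" where
  "hasse_disconnected le S \<longleftrightarrow>
    (\<exists>a\<in>S. \<exists>b\<in>S. \<not> (\<lambda>x y. hasse_edge le S x y \<or> hasse_edge le S y x)\<^sup>*\<^sup>* a b)"

definition is_partition :: "nat list \<Rightarrow> bool" where
  "is_partition lam \<longleftrightarrow> sorted_wrt (\<ge>) lam \<and> 0 \<notin> set lam"

text \<open>A tableau is the list of its rows, top row first; the cell \<open>(r, c)\<close> has row index \<open>r\<close> and column
  index \<open>c\<close>, both counted from 0.\<close>

type_synonym tableau = "nat list list"

definition ssyt :: "nat \<Rightarrow> nat list \<Rightarrow> tableau set" where
  "ssyt n lam = {T. map length T = lam \<and>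
     (\<forall>row\<in>set T. set row \<subseteq> {1..n} \<and> sorted row) \<and>
     (\<forall>r c. Suc r < length T \<and> c < length (T ! Suc r) \<longrightarrow> T ! r ! c < T ! Suc r ! c)}"

definition reading_cells :: "nat list \<Rightarrow> (nat \<times> nat) list" where
  "reading_cells lam =
    [(r, c). c \<leftarrow> [0..<(case lam of [] \<Rightarrow> 0 | l # _ \<Rightarrow> l)], r \<leftarrow> rev [0..<length lam], c < lam ! r]"

datatype sign = Plus | Minus

definition signature :: "nat \<Rightarrow> tableau \<Rightarrow> (sign \<times> nat \<times> nat) list" where
  "signature i T =
    [(if T ! r ! c = i then Plus else Minus, (r, c)).
      (r, c) \<leftarrow> reading_cells (map length T), T ! r ! c \<in> {i, Suc i}]"

fun cancel :: "(sign \<times> 'a) list \<Rightarrow> (sign \<times> 'a) list" where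
  "cancel [] = []"
| "cancel (x # xs) =
    (case cancel xs of
       [] \<Rightarrow> [x]
     | y # ys \<Rightarrow> if fst x = Minus \<and> fst y = Plus then ys else x # y # ys)"

text \<open>The following facts show that \<open>cancel w\<close> is the unique word obtained from \<open>w\<close> by deleting
  adjacent pairs \<open>-+\<close> until none is left.\<close>

inductive cancel_step :: "(sign \<times> 'a) list \<Rightarrow> (sign \<times> 'a) list \<Rightarrow> bool" where
  "cancel_step (xs @ (Minus, a) # (Plus, b) # ys) (xs @ ys)"

lemma cancel_step_Cons: "cancel_step v w \<Longrightarrow> cancel_step (x # v) (x # w)"
  by (metis append_Cons cancel_step.cases cancel_step.intros)

lemma cancel_steps_Cons: "cancel_step\<^sup>*\<^sup>* v w \<Longrightarrow> cancel_step\<^sup>*\<^sup>* (x # v) (x # w)"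
  by (induction rule: rtranclp_induct) (auto intro: cancel_step_Cons rtranclp.rtrancl_into_rtrancl)

lemma cancel_reachable: "cancel_step\<^sup>*\<^sup>* w (cancel w)"
proof (induction w)
  case (Cons x xs)
  have *: "cancel_step\<^sup>*\<^sup>* (x # xs) (x # cancel xs)"
    using Cons by (rule cancel_steps_Cons)
  show ?case
  proof (cases "\<exists>a b ys. x = (Minus, a) \<and> cancel xs = (Plus, b) # ys")
    case True
    then obtain a b ys where x: "x = (Minus, a)" "cancel xs = (Plus, b) # ys" by blast
    then have "cancel_step (x # cancel xs) ys"
      using cancel_step.intros[of "[]" a b ys] by simp
    then show ?thesis using * x by simp
  next
    case False
    then have "cancel (x # xs) = x # cancel xs"
      by (cases x) (auto split: list.splits)
    then show ?thesis using * by simp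
  qed
qed simp

lemma cancel_form: "\<exists>ps ms. cancel w = ps @ ms \<and> fst ` set ps \<subseteq> {Plus} \<and> fst ` set ms \<subseteq> {Minus}"
proof (induction w)
  case (Cons x xs)
  then obtain ps ms where *: "cancel xs = ps @ ms" "fst ` set ps \<subseteq> {Plus}" "fst ` set ms \<subseteq> {Minus}"
    by blast
  show ?case
  proof (cases "fst x")
    case Plus
    then have "cancel (x # xs) = (x # ps) @ ms" using * by (auto split: list.splits)
    then show ?thesis using * Plus by (intro exI[of _ "x # ps"] exI[of _ ms]) auto
  next
    case Minus
    show ?thesis
    proof (cases ps)
      case Nil
      then have "cancel (x # xs) = [] @ (x # ms)" using * by (auto split: list.splits)
      then show ?thesis using * Minus by (intro exI[of _ "[]"] exI[of _ "x # ms"]) auto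
    next
      case (Cons p ps')
      then have "cancel (x # xs) = ps' @ ms" using * Minus by auto
      then show ?thesis using * Cons by (intro exI[of _ ps'] exI[of _ ms]) auto
    qed
  qed
qed auto

lemma cancel_append_cong: "cancel v = cancel w \<Longrightarrow> cancel (xs @ v) = cancel (xs @ w)"
  by (induction xs) auto

lemma cancel_invariant: "cancel_step v w \<Longrightarrow> cancel v = cancel w"
proof (induction rule: cancel_step.induct)
  case (1 xs a b ys)
  show ?case by (rule cancel_append_cong) (auto split: list.splits)
qed

definition crystal_f :: "nat \<Rightarrow> tableau \<Rightarrow> tableau option" where
  "crystal_f i T =
    (let ps = [p. (s, p) \<leftarrow> cancel (signature i T), s = Plus] in
     if ps = [] then None
     else let (r, c) = last ps in Some (T[r := (T ! r)[c := Suc i]]))"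

definition crystal_le :: "nat \<Rightarrow> nat list \<Rightarrow> tableau \<Rightarrow> tableau \<Rightarrow> bool" where
  "crystal_le n lam T T' \<longleftrightarrow> T \<in> ssyt n lam \<and> T' \<in> ssyt n lam \<and>
     (\<lambda>S S'. \<exists>i\<in>{1..<n}. crystal_f i S = Some S')\<^sup>*\<^sup>* T T'"

end

theory Submission imports Defs begin

text \<open>Take \<open>lam = (2,2)\<close> and the interval from \<open>u = [[1,1],[2,n]]\<close> to \<open>v = [[1,n-1],[n,n]]\<close>. Entries
  only grow along the order, so every element of \<open>[u,v]\<close> has the form \<open>[[1,b],[c,n]]\<close>, with column
  reading word \<open>c 1 n b\<close>. A crystal operator raises \<open>b\<close> or \<open>c\<close> by one. By the signature rule \<open>b\<close>
  cannot be raised when \<open>c = b + 1\<close>, except at \<open>u\<close>, where \<open>c = 2\<close> is cancelled by the entry \<open>1\<close> between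
  \<open>c\<close> and \<open>b\<close>; and \<open>c\<close> cannot be raised when \<open>c = b\<close>, except when \<open>b = c = n - 1\<close>, where \<open>b\<close> is
  cancelled by the entry \<open>n\<close>, and this step leads to \<open>v\<close>. So no step inside \<open>(u,v)\<close> crosses between the
  nonempty regions \<open>b < c\<close> and \<open>c \<le> b\<close>, and a move connecting chains in different regions must replace
  a whole chain from \<open>u\<close> to \<open>v\<close>.\<close>

section \<open>Maximal chains of finite relations\<close>

lemma chain_extends_to_maxchain:
  assumes "finite A" and "pred_on.chain A le C"
  shows "\<exists>M. pred_on.maxchain A le M \<and> C \<subseteq> M"
proof -
  let ?F = "{S. pred_on.chain A le S}"
  have "finite ?F"
    by (rule finite_subset[of _ "Pow A"]) (use assms(1) in \<open>auto simp: pred_on.chain_def\<close>)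
  then obtain M where "M \<in> ?F" "C \<subseteq> M" "\<forall>S\<in>?F. M \<subseteq> S \<longrightarrow> M = S"
    using finite_has_maximal2[of ?F C] assms(2) by auto
  then show ?thesis
    unfolding pred_on.maxchain_def by (intro exI[of _ M]) auto
qed

lemma finite_maxchain_lengths:
  assumes "finite A"
  shows "finite {card C - 1 | C. pred_on.maxchain A le C}"
proof -
  have "{card C - 1 | C. pred_on.maxchain A le C} \<subseteq> (\<lambda>C. card C - 1) ` Pow A"
    by (auto simp: pred_on.maxchain_def pred_on.chain_def)
  then show ?thesis
    using assms by (meson finite_Pow_iff finite_imageI finite_subset)
qed

text \<open>Since \<open>poset_rank\<close> is a maximum over maximal chains, a single chain bounds
  it from below: extend the chain to a maximal one.\<close>

lemma chain_length_le_poset_rank: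
  assumes "finite A" and "pred_on.chain A le C"
  shows "card C - 1 \<le> poset_rank le A"
proof -
  obtain M where M: "pred_on.maxchain A le M" "C \<subseteq> M"
    using chain_extends_to_maxchain[OF assms] by blast
  then have "M \<subseteq> A"
    by (simp add: pred_on.maxchain_def pred_on.chain_def)
  then have "card C \<le> card M"
    using M(2) assms(1) by (meson card_mono finite_subset)
  moreover have "card M - 1 \<le> poset_rank le A"
    unfolding poset_rank_def using M(1) by (intro Max_ge finite_maxchain_lengths[OF assms(1)]) auto
  ultimately show ?thesis by linarith
qed

lemma poset_rank_attained:
  assumes "finite A"
  shows "\<exists>C. pred_on.maxchain A le C \<and> poset_rank le A = card C - 1"
proof -
  \<comment> \<open>Extending the empty chain shows that the set under \<open>Max\<close> is
    nonempty, so that \<open>Max\<close> is one of its members.\<close>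
  have "pred_on.chain A le {}" by (simp add: pred_on.chain_def)
  then have "{card C - 1 | C. pred_on.maxchain A le C} \<noteq> {}"
    using chain_extends_to_maxchain[OF assms] by blast
  then show ?thesis
    using Max_in[OF finite_maxchain_lengths[OF assms, of le]] unfolding poset_rank_def by blast
qed

section \<open>Two by two tableaux\<close>

lemma ssyt_22_iff:
  "T \<in> ssyt n [2, 2] \<longleftrightarrow> (\<exists>a b c d. T = [[a, b], [c, d]] \<and> 1 \<le> a \<and> a \<le> b \<and> c \<le> d \<and> a < c \<and> b < d \<and> d \<le> n)"
proof
  assume T: "T \<in> ssyt n [2, 2]"
  then have "map length T = [2, 2]" by (simp add: ssyt_def)
  then obtain a b c d where T': "T = [[a, b], [c, d]]"
    by (auto simp: map_eq_Cons_conv length_Suc_conv numeral_2_eq_2)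
  have "\<And>r k. Suc r < length T \<and> k < length (T ! Suc r) \<Longrightarrow> T ! r ! k < T ! Suc r ! k"
    using T by (simp add: ssyt_def)
  from this[of 0 0] this[of 0 1] have "a < c" "b < d" by (simp_all add: T')
  then show "\<exists>a b c d. T = [[a, b], [c, d]] \<and> 1 \<le> a \<and> a \<le> b \<and> c \<le> d \<and> a < c \<and> b < d \<and> d \<le> n"
    using T by (auto simp: ssyt_def T')
qed (auto simp: ssyt_def less_Suc_eq)

lemma finite_ssyt_22: "finite (ssyt n [2, 2])"
proof (rule finite_subset)
  let ?L = "{xs. set xs \<subseteq> {0..n} \<and> length xs = 2}"
  show "ssyt n [2, 2] \<subseteq> {T. set T \<subseteq> ?L \<and> length T = 2}"
    by (auto simp: ssyt_22_iff)
  show "finite {T. set T \<subseteq> ?L \<and> length T = 2}"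
    by (intro finite_lists_length_eq) simp
qed

text \<open>Columns are read from left to right and bottom to top, so the letters come in the order
  \<open>c\<close>, \<open>a\<close>, \<open>d\<close>, \<open>b\<close>.\<close>

lemma signature_22:
  "signature i [[a, b], [c, d]] =
    (if c = i then [(Plus, (1, 0))] else if c = Suc i then [(Minus, (1, 0))] else []) @
    (if a = i then [(Plus, (0, 0))] else if a = Suc i then [(Minus, (0, 0))] else []) @
    (if d = i then [(Plus, (1, 1))] else if d = Suc i then [(Minus, (1, 1))] else []) @
    (if b = i then [(Plus, (0, 1))] else if b = Suc i then [(Minus, (0, 1))] else [])"
  by (simp add: signature_def reading_cells_def upt_rec numeral_2_eq_2)

lemma set_cancel_subset: "set (cancel w) \<subseteq> set w"
  by (induction w) (auto split: list.splits if_splits)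

text \<open>Cancellation only deletes letters, so the changed cell is already a plus of the full
  signature. This restricts the effect of an operator without computing the cancellation.\<close>

lemma crystal_f_changes_signature_cell:
  assumes "crystal_f i T = Some T'"
  obtains r c where "(Plus, (r, c)) \<in> set (signature i T)" "T' = T[r := (T ! r)[c := Suc i]]"
proof -
  define ps where "ps = [p. (s, p) \<leftarrow> cancel (signature i T), s = Plus]"
  have "ps \<noteq> []" and T': "T' = (let (r, c) = last ps in T[r := (T ! r)[c := Suc i]])"
    using assms unfolding crystal_f_def ps_def[symmetric] by (auto simp: Let_def split: if_splits prod.splits)
  then have "last ps \<in> set ps" by simp
  then have "(Plus, last ps) \<in> set (signature i T)"
    using set_cancel_subset[of "signature i T"] by (auto simp: ps_def split: if_splits)
  then show ?thesis
    using that T' by (cases "last ps") auto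
qed

lemma crystal_f_22_cases:
  assumes "crystal_f i [[a, b], [c, d]] = Some T"
  shows "a = i \<and> T = [[Suc i, b], [c, d]] \<or> b = i \<and> T = [[a, Suc i], [c, d]] \<or>
    c = i \<and> T = [[a, b], [Suc i, d]] \<or> d = i \<and> T = [[a, b], [c, Suc i]]"
  using assms
proof (rule crystal_f_changes_signature_cell)
  fix r k
  assume "(Plus, (r, k)) \<in> set (signature i [[a, b], [c, d]])"
    "T = [[a, b], [c, d]][r := ([[a, b], [c, d]] ! r)[k := Suc i]]"
  then show ?thesis
    by (auto simp: signature_22 split: if_splits)
qed

section \<open>Crystal operators on tableaux with corner entries 1 and \<open>n\<close>\<close>

definition corner_tab :: "nat \<Rightarrow> nat \<Rightarrow> nat \<Rightarrow> tableau" where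
  "corner_tab n b c = [[1, b], [c, n]]"

text \<open>The letter \<open>b\<close> is read last, so its plus is changed unless it is cancelled.
  As \<open>Suc b < n\<close>, the only possible minus is \<open>c = Suc b\<close>; for
  \<open>b = 1\<close> the corner entry 1 absorbs it first, the word being
  \<open>-++\<close>.\<close>

lemma crystal_f_corner_tab_raise_b:
  assumes "1 \<le> b" "Suc b < n" "2 \<le> c" "b = 1 \<or> c \<noteq> Suc b"
  shows "crystal_f b (corner_tab n b c) = Some (corner_tab n (Suc b) c)"
proof -
  consider "b = 1" "c = 2" | "b = 1" "c \<noteq> 2" | "b \<noteq> 1" "c = b" | "b \<noteq> 1" "c \<noteq> b" "c \<noteq> Suc b"
    using assms by auto
  then show ?thesis
    using assms by cases (simp_all add: crystal_f_def corner_tab_def signature_22)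
qed

text \<open>The word is \<open>-+\<close>, or \<open>--+\<close> if \<open>n = Suc b\<close>; the
  only plus is cancelled.\<close>

lemma crystal_f_corner_tab_blocked:
  assumes "1 < b" "Suc b \<le> n"
  shows "crystal_f b (corner_tab n b (Suc b)) = None"
  using assms by (cases "n = Suc b") (simp_all add: crystal_f_def corner_tab_def signature_22)

text \<open>The letter \<open>c\<close> is read first, so its plus is never cancelled. It is the
  rightmost surviving plus unless \<open>b = c\<close> contributes a later one, and that one is
  cancelled by the minus of the corner \<open>n\<close> if \<open>Suc c = n\<close>.\<close>

lemma crystal_f_corner_tab_raise_c:
  assumes "2 \<le> c" "c < n" "Suc c = n \<or> c \<noteq> b"
  shows "crystal_f c (corner_tab n b c) = Some (corner_tab n b (Suc c))"
proof -
  consider "Suc c = n" "b = c" | "Suc c = n" "b = Suc c" | "Suc c = n" "b \<noteq> c" "b \<noteq> Suc c"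
    | "Suc c \<noteq> n" "b = Suc c" | "Suc c \<noteq> n" "b \<noteq> c" "b \<noteq> Suc c"
    using assms by auto
  then show ?thesis
    using assms by cases (simp_all add: crystal_f_def corner_tab_def signature_22)
qed

lemma crystal_f_corner_tab_cases:
  assumes f: "crystal_f i (corner_tab n b c) = Some (corner_tab n b' c')"
    and "1 \<le> b" "2 \<le> c" "c \<le> n" "i < n"
  shows "b' = Suc b \<and> c' = c \<and> (b = 1 \<or> c \<noteq> Suc b) \<or> b' = b \<and> c' = Suc c \<and> (Suc c = n \<or> c \<noteq> b)"
proof -
  have "b = i \<and> b' = Suc b \<and> c' = c \<or> c = i \<and> b' = b \<and> c' = Suc c"
    using crystal_f_22_cases[OF f[unfolded corner_tab_def]] by (auto simp: corner_tab_def)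
  then consider "b = i" "b' = Suc b" "c' = c" | "c = i" "b' = b" "c' = Suc c" by blast
  then show ?thesis
  proof cases
    case 1
    then show ?thesis
      using assms crystal_f_corner_tab_blocked[of b n] by auto
  next
    case 2
    \<comment> \<open>If \<open>b = c\<close> and \<open>Suc c < n\<close>, the same operator raises
      \<open>b\<close>, which contradicts that it raised \<open>c\<close>.\<close>
    then show ?thesis
      using assms crystal_f_corner_tab_raise_b[of b n c] by (auto simp: corner_tab_def)
  qed
qed

text \<open>Each operator raises one entry by one. This later fixes the corner entries in the
  interval and gives antisymmetry of the order.\<close>

lemma crystal_path_22_mono:
  assumes "(\<lambda>S S'. \<exists>i\<in>I. crystal_f i S = Some S')\<^sup>*\<^sup>* [[a, b], [c, d]] T"
  shows "\<exists>a' b' c' d'. T = [[a', b'], [c', d']] \<and> a \<le> a' \<and> b \<le> b' \<and> c \<le> c' \<and> d \<le> d'"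
  using assms
proof (induction rule: rtranclp_induct)
  case (step T U)
  then obtain a' b' c' d' where T: "T = [[a', b'], [c', d']]" "a \<le> a'" "b \<le> b'" "c \<le> c'" "d \<le> d'"
    by blast
  from step.hyps(2) obtain i where "crystal_f i [[a', b'], [c', d']] = Some U"
    unfolding T(1) by blast
  then show ?case
    using T(2-) crystal_f_22_cases by fastforce
qed auto

section \<open>The order on corner tableaux and runs of steps in one entry\<close>

lemma corner_tab_in_ssyt: "1 \<le> b \<Longrightarrow> b < n \<Longrightarrow> 2 \<le> c \<Longrightarrow> c \<le> n \<Longrightarrow> corner_tab n b c \<in> ssyt n [2, 2]"
  by (auto simp: ssyt_22_iff corner_tab_def)

lemma corner_tab_eq_iff [simp]: "corner_tab n b c = corner_tab n b' c' \<longleftrightarrow> b = b' \<and> c = c'"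
  by (simp add: corner_tab_def)

lemma crystal_le_refl: "T \<in> ssyt n lam \<Longrightarrow> crystal_le n lam T T"
  by (simp add: crystal_le_def)

lemma crystal_le_trans: "crystal_le n lam S T \<Longrightarrow> crystal_le n lam T U \<Longrightarrow> crystal_le n lam S U"
  unfolding crystal_le_def by (meson rtranclp_trans)

lemma crystal_le_step:
  "crystal_f i S = Some T \<Longrightarrow> i \<in> {1..<n} \<Longrightarrow> S \<in> ssyt n lam \<Longrightarrow> T \<in> ssyt n lam \<Longrightarrow> crystal_le n lam S T"
  unfolding crystal_le_def by blast

lemma crystal_le_corner_tab_raise_b:
  assumes "b \<le> b'" "1 \<le> b" "b' < n" "2 \<le> c" "c \<le> n" "\<And>k. b \<le> k \<Longrightarrow> k < b' \<Longrightarrow> k = 1 \<or> c \<noteq> Suc k"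
  shows "crystal_le n [2, 2] (corner_tab n b c) (corner_tab n b' c)"
  using assms
proof (induction b' rule: dec_induct)
  case base
  then show ?case by (simp add: crystal_le_refl corner_tab_in_ssyt)
next
  case (step k)
  have "crystal_le n [2, 2] (corner_tab n k c) (corner_tab n (Suc k) c)"
    using step.hyps step.prems(1-4) step.prems(5)[of k]
    by (intro crystal_le_step[OF crystal_f_corner_tab_raise_b] corner_tab_in_ssyt) auto
  moreover have "crystal_le n [2, 2] (corner_tab n b c) (corner_tab n k c)"
    using step.prems(1-4) by (intro step.IH step.prems(5)) auto
  ultimately show ?case by (rule crystal_le_trans[rotated])
qed

lemma crystal_le_corner_tab_raise_c:
  assumes "c \<le> c'" "1 \<le> b" "b < n" "2 \<le> c" "c' \<le> n" "\<And>k. c \<le> k \<Longrightarrow> k < c' \<Longrightarrow> Suc k = n \<or> k \<noteq> b"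
  shows "crystal_le n [2, 2] (corner_tab n b c) (corner_tab n b c')"
  using assms
proof (induction c' rule: dec_induct)
  case base
  then show ?case by (simp add: crystal_le_refl corner_tab_in_ssyt)
next
  case (step k)
  have "crystal_le n [2, 2] (corner_tab n b k) (corner_tab n b (Suc k))"
    using step.hyps step.prems(1-4) step.prems(5)[of k]
    by (intro crystal_le_step[OF crystal_f_corner_tab_raise_c] corner_tab_in_ssyt) auto
  moreover have "crystal_le n [2, 2] (corner_tab n b c) (corner_tab n b k)"
    using step.prems(1-4) by (intro step.IH step.prems(5)) auto
  ultimately show ?case by (rule crystal_le_trans[rotated])
qed

section \<open>The interval with two components\<close>

text \<open>The truth of \<open>b < c\<close> can change only by raising \<open>b\<close> at
  \<open>c = Suc b\<close> or raising \<open>c\<close> at \<open>c = b\<close>. The signature rule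
  allows the former only at \<open>(1, 2)\<close> and the latter only on arrival at
  \<open>(n - 1, n)\<close>; both positions are excluded.\<close>

lemma crystal_path_same_side:
  assumes "(\<lambda>S S'. \<exists>i\<in>{1..<n}. crystal_f i S = Some S')\<^sup>*\<^sup>* (corner_tab n b c) (corner_tab n b' c')"
    and "1 \<le> b" "2 \<le> c" "b' < n" "c' \<le> n" "4 \<le> n"
    and "(b, c) \<noteq> (1, 2)" "(b', c') \<noteq> (n - 1, n)"
  shows "b < c \<longleftrightarrow> b' < c'"
  using assms(1,4,5,8)
proof (induction "corner_tab n b' c'" arbitrary: b' c' rule: rtranclp_induct)
  case base
  then show ?case by simp
next
  case (step z)
  \<comment> \<open>The last intermediate tableau \<open>z\<close> lies between two corner tableaux,
    so monotonicity forces its corners to be 1 and \<open>n\<close>.\<close>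
  obtain p q r s where z: "z = [[p, q], [r, s]]" "1 \<le> p" "b \<le> q" "c \<le> r" "n \<le> s"
    using crystal_path_22_mono[OF step.hyps(1)[unfolded corner_tab_def]] by blast
  have "p \<le> 1" "q \<le> b'" "r \<le> c'" "s \<le> n"
    using crystal_path_22_mono[OF r_into_rtranclp, of "{1..<n}", OF step.hyps(2)[unfolded z corner_tab_def]] by auto
  then have zc: "z = corner_tab n q r" and q: "1 \<le> q" "q < n" and r: "2 \<le> r" "r \<le> n"
    using z assms(2,3) step.prems by (auto simp: corner_tab_def)
  obtain i where "crystal_f i (corner_tab n q r) = Some (corner_tab n b' c')" "i < n"
    using step.hyps(2) zc by auto
  then have move: "(b' = Suc q \<and> c' = r \<and> (q = 1 \<or> r \<noteq> Suc q)) \<or> (b' = q \<and> c' = Suc r \<and> (Suc r = n \<or> r \<noteq> q))"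
    using q r by (intro crystal_f_corner_tab_cases)
  \<comment> \<open>A step from \<open>(n - 1, n)\<close> would violate \<open>b' < n\<close> or
    \<open>c' \<le> n\<close>; hence the induction hypothesis applies to \<open>z\<close>.\<close>
  have "(q, r) \<noteq> (n - 1, n)"
    using move step.prems by auto
  then have "b < c \<longleftrightarrow> q < r"
    using step.hyps(3)[OF zc] q r by blast
  \<comment> \<open>Entries only grow, so \<open>z\<close> could be at \<open>(1, 2)\<close> only if
    the path started there.\<close>
  moreover have "(q, r) \<noteq> (1, 2)"
    using z assms(2,3,7) by auto
  ultimately show ?case
    using move q r step.prems by auto
qed

section \<open>The interval and its two regions\<close>

definition lower_end :: "nat \<Rightarrow> tableau" where "lower_end n = corner_tab n 1 2"

definition upper_end :: "nat \<Rightarrow> tableau" where "upper_end n = corner_tab n (n - 1) n"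

definition right_side :: "nat \<Rightarrow> tableau set" where
  "right_side n = {corner_tab n b c | b c. b < c}"

text \<open>The upper end bounds the top left entry by 1 and the lower end bounds the bottom right
  entry below by \<open>n\<close>, so both corners are fixed.\<close>

lemma closed_interval_cases:
  assumes "T \<in> closed_interval (crystal_le n [2, 2]) (lower_end n) (upper_end n)"
  obtains b c where "T = corner_tab n b c" "1 \<le> b" "b < n" "2 \<le> c" "c \<le> n"
proof -
  have T: "T \<in> ssyt n [2, 2]" and
    path: "(\<lambda>S S'. \<exists>i\<in>{1..<n}. crystal_f i S = Some S')\<^sup>*\<^sup>* T (corner_tab n (n - 1) n)"
      "(\<lambda>S S'. \<exists>i\<in>{1..<n}. crystal_f i S = Some S')\<^sup>*\<^sup>* (corner_tab n 1 2) T"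
    using assms by (auto simp: closed_interval_def crystal_le_def lower_end_def upper_end_def)
  obtain a b c d where abcd: "T = [[a, b], [c, d]]" "1 \<le> a" "a \<le> b" "c \<le> d" "a < c" "b < d" "d \<le> n"
    using T by (auto simp: ssyt_22_iff)
  have "a \<le> 1" "n \<le> d"
    using crystal_path_22_mono[OF path(1)[unfolded abcd(1)]] crystal_path_22_mono[OF path(2)[unfolded corner_tab_def]]
    by (auto simp: abcd(1) corner_tab_def)
  then have "T = corner_tab n b c" "1 \<le> b" "b < n" "2 \<le> c" "c \<le> n"
    using abcd by (auto simp: corner_tab_def)
  then show ?thesis by (rule that)
qed

text \<open>Formulated for comparable elements, so that it serves both for Hasse edges and for
  elements of a common chain.\<close>

lemma comparable_same_side:
  assumes "4 \<le> n" and le: "crystal_le n [2, 2] S T"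
    and "S \<in> closed_interval (crystal_le n [2, 2]) (lower_end n) (upper_end n)"
    and "T \<in> closed_interval (crystal_le n [2, 2]) (lower_end n) (upper_end n)"
    and "S \<noteq> lower_end n" "T \<noteq> upper_end n"
  shows "S \<in> right_side n \<longleftrightarrow> T \<in> right_side n"
proof -
  obtain b c where S: "S = corner_tab n b c" "1 \<le> b" "2 \<le> c"
    using closed_interval_cases[OF assms(3)] by metis
  obtain b' c' where T: "T = corner_tab n b' c'" "b' < n" "c' \<le> n"
    using closed_interval_cases[OF assms(4)] by metis
  have "b < c \<longleftrightarrow> b' < c'"
    using le S T assms(1,5,6) unfolding crystal_le_def lower_end_def upper_end_def
    by (intro crystal_path_same_side[of n b c b' c']) auto
  then show ?thesis by (simp add: right_side_def S T)
qed

lemma crystal_le_antisym_22: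
  assumes "crystal_le n [2, 2] S T" "crystal_le n [2, 2] T S"
  shows "S = T"
proof -
  obtain a b c d where S: "S = [[a, b], [c, d]]"
    using assms(1) by (auto simp: crystal_le_def ssyt_22_iff)
  obtain a' b' c' d' where T: "T = [[a', b'], [c', d']]"
    using assms(1) by (auto simp: crystal_le_def ssyt_22_iff)
  have "(\<lambda>S S'. \<exists>i\<in>{1..<n}. crystal_f i S = Some S')\<^sup>*\<^sup>* S T" "(\<lambda>S S'. \<exists>i\<in>{1..<n}. crystal_f i S = Some S')\<^sup>*\<^sup>* T S"
    using assms by (auto simp: crystal_le_def)
  from this[unfolded S T, THEN crystal_path_22_mono] show ?thesis
    by (auto simp: S T)
qed

section \<open>Explicit paths through both regions\<close>

lemma right_path:
  assumes "4 \<le> n" "2 \<le> c" "c \<le> c'" "c' \<le> n"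
  shows "crystal_le n [2, 2] (corner_tab n 1 c) (corner_tab n 1 c')"
  using assms by (intro crystal_le_corner_tab_raise_c) auto

lemma right_path_end:
  assumes "4 \<le> n" "2 \<le> c" "c \<le> n"
  shows "crystal_le n [2, 2] (corner_tab n 1 c) (upper_end n)"
proof (rule crystal_le_trans[OF right_path])
  \<comment> \<open>With \<open>c = n\<close>, the obstruction \<open>c = Suc b\<close> is met only
    at \<open>b = n - 1\<close>, where this run ends.\<close>
  show "crystal_le n [2, 2] (corner_tab n 1 n) (upper_end n)"
    unfolding upper_end_def using assms by (intro crystal_le_corner_tab_raise_b) auto
qed (use assms in auto)

lemma right_path_in_open_interval:
  assumes "4 \<le> n" "3 \<le> c" "c \<le> n"
  shows "corner_tab n 1 c \<in> open_interval (crystal_le n [2, 2]) (lower_end n) (upper_end n)"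
  using assms right_path[of n 2 c] right_path_end[of n c]
  by (auto simp: open_interval_def strict_less_def lower_end_def upper_end_def)

text \<open>The path goes through the positions \<open>(1, 2)\<close>, \<open>(2, 2)\<close>,
  \<open>(n - 1, 2)\<close>, \<open>(n - 1, n)\<close>. Its first and last steps are the two
  exceptional ones, which enter and leave the region \<open>c \<le> b\<close>.\<close>

lemma left_point_in_open_interval:
  assumes "4 \<le> n"
  shows "corner_tab n 2 2 \<in> open_interval (crystal_le n [2, 2]) (lower_end n) (upper_end n)"
proof -
  have "crystal_le n [2, 2] (corner_tab n 1 2) (corner_tab n 2 2)"
    using assms by (intro crystal_le_corner_tab_raise_b) auto
  moreover have "crystal_le n [2, 2] (corner_tab n 2 2) (corner_tab n (n - 1) 2)"
    using assms by (intro crystal_le_corner_tab_raise_b) auto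
  moreover have "crystal_le n [2, 2] (corner_tab n (n - 1) 2) (corner_tab n (n - 1) n)"
    using assms by (intro crystal_le_corner_tab_raise_c) auto
  ultimately show ?thesis
    using assms crystal_le_trans[of n "[2, 2]" "corner_tab n 2 2"]
    by (auto simp: open_interval_def strict_less_def lower_end_def upper_end_def)
qed

section \<open>Rank and disconnectedness of the open interval\<close>

lemma finite_crystal_interval: "finite (closed_interval (crystal_le n [2, 2]) u v)"
  by (rule finite_subset[OF _ finite_ssyt_22[of n]]) (auto simp: closed_interval_def crystal_le_def)

lemma open_subset_closed_interval: "open_interval le u v \<subseteq> closed_interval le u v"
  by (auto simp: open_interval_def closed_interval_def strict_less_def)

lemma right_path_chain:
  assumes "4 \<le> n"
  shows "pred_on.chain (open_interval (crystal_le n [2, 2]) (lower_end n) (upper_end n))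
    (crystal_le n [2, 2]) (corner_tab n 1 ` {3..n})"
proof -
  have "crystal_le n [2, 2] (corner_tab n 1 x) (corner_tab n 1 y) \<or>
      crystal_le n [2, 2] (corner_tab n 1 y) (corner_tab n 1 x)"
    if "x \<in> {3..n}" "y \<in> {3..n}" for x y
    using that right_path[OF assms, of x y] right_path[OF assms, of y x] by (cases x y rule: le_cases) auto
  then show ?thesis
    unfolding pred_on.chain_def using right_path_in_open_interval[OF assms] by force
qed

lemma card_right_path: "card (corner_tab n 1 ` {3..n}) = n - 2"
  by (subst card_image) (auto simp: inj_on_def)

lemma open_interval_rank:
  assumes "4 \<le> n"
  shows "n - 3 \<le> poset_rank (crystal_le n [2, 2])
    (open_interval (crystal_le n [2, 2]) (lower_end n) (upper_end n))"
  using chain_length_le_poset_rank[OF _ right_path_chain[OF assms]] card_right_path[of n]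
    finite_subset[OF open_subset_closed_interval finite_crystal_interval]
  by simp

lemma open_interval_disconnected:
  assumes "4 \<le> n"
  shows "hasse_disconnected (crystal_le n [2, 2])
    (open_interval (crystal_le n [2, 2]) (lower_end n) (upper_end n))"
proof -
  let ?le = "crystal_le n [2, 2]"
  let ?O = "open_interval ?le (lower_end n) (upper_end n)"
  \<comment> \<open>Membership in \<open>right_side n\<close> is invariant along Hasse edges, hence
    along walks; the points at \<open>(1, 3)\<close> and \<open>(2, 2)\<close> differ in it.\<close>
  have edge: "x \<in> right_side n \<longleftrightarrow> y \<in> right_side n" if "hasse_edge ?le ?O x y" for x y
    using that assms open_subset_closed_interval[of ?le "lower_end n" "upper_end n"]
    by (intro comparable_same_side) (auto simp: hasse_edge_def open_interval_def strict_less_def)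
  have "x \<in> right_side n \<longleftrightarrow> y \<in> right_side n"
    if "(\<lambda>x y. hasse_edge ?le ?O x y \<or> hasse_edge ?le ?O y x)\<^sup>*\<^sup>* x y" for x y
    using that by (induction rule: rtranclp_induct) (use edge in blast)+
  moreover have "corner_tab n 1 3 \<in> right_side n" "corner_tab n 2 2 \<notin> right_side n"
    by (auto simp: right_side_def)
  ultimately show ?thesis
    unfolding hasse_disconnected_def
    using right_path_in_open_interval[OF assms, of 3] left_point_in_open_interval[OF assms] assms
    by force
qed

section \<open>Rank differences and bounded chain moves\<close>

lemma elem_rank_ends_diff:
  assumes "4 \<le> n"
  shows "elem_rank (crystal_le n [2, 2]) (lower_end n) + (n - 2) \<le> elem_rank (crystal_le n [2, 2]) (upper_end n)"
proof -
  let ?le = "crystal_le n [2, 2]" and ?P = "corner_tab n 1 ` {3..n}"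
  let ?A = "\<lambda>x. {z. ?le z x}"
  have fin: "finite (?A x)" for x
    by (rule finite_subset[OF _ finite_ssyt_22[of n]]) (auto simp: crystal_le_def)
  \<comment> \<open>\<open>elem_rank\<close> counts from the bottom of the whole crystal, where
    \<open>lower_end n\<close> is not minimal. So a chain attaining the rank of
    \<open>lower_end n\<close> is prolonged by the \<open>n - 2\<close> elements of
    \<open>?P\<close>.\<close>
  obtain C where C: "pred_on.maxchain (?A (lower_end n)) ?le C"
    and rank: "elem_rank ?le (lower_end n) = card C - 1"
    using poset_rank_attained[OF fin] unfolding elem_rank_def by blast
  have CA: "C \<subseteq> ?A (lower_end n)"
    using C by (simp add: pred_on.maxchain_def pred_on.chain_def)
  have refl: "?le (lower_end n) (lower_end n)"
    using assms by (simp add: lower_end_def crystal_le_refl corner_tab_in_ssyt)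
  \<comment> \<open>Nonemptiness keeps the subtraction in \<open>card C - 1\<close> from being
    truncated.\<close>
  have "C \<noteq> {}"
  proof
    assume "C = {}"
    moreover have "pred_on.chain (?A (lower_end n)) ?le {lower_end n}"
      using refl by (simp add: pred_on.chain_def)
    ultimately show False
      using C by (auto simp: pred_on.maxchain_def)
  qed
  then have "0 < card C"
    using finite_subset[OF CA fin] by (simp add: card_gt_0_iff)
  have le_P: "?le z p" if "z \<in> C" "p \<in> ?P" for z p
    using that CA right_path[OF assms, of 2] crystal_le_trans[of n "[2,2]" z "lower_end n" p]
    by (auto simp: lower_end_def)
  have "C \<inter> ?P = {}"
  proof (rule ccontr)
    assume "C \<inter> ?P \<noteq> {}"
    then obtain c where c: "3 \<le> c" "c \<le> n" "?le (corner_tab n 1 c) (lower_end n)"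
      using CA by fastforce
    then have "corner_tab n 1 c = lower_end n"
      using right_path[OF assms, of 2 c] by (intro crystal_le_antisym_22) (auto simp: lower_end_def)
    then show False using c by (simp add: lower_end_def)
  qed
  then have card: "card (C \<union> ?P) = card C + (n - 2)"
    using finite_subset[OF CA fin] card_right_path[of n] by (simp add: card_Un_disjoint)
  have "?le (lower_end n) (upper_end n)"
    unfolding lower_end_def using assms by (intro right_path_end) auto
  then have "C \<union> ?P \<subseteq> ?A (upper_end n)"
    using CA right_path_end[OF assms] crystal_le_trans[of n "[2,2]" _ "lower_end n"] by auto
  moreover have "\<forall>x\<in>C. \<forall>y\<in>C. ?le\<^sup>=\<^sup>= x y \<or> ?le\<^sup>=\<^sup>= y x"
    using C by (simp add: pred_on.maxchain_def pred_on.chain_def)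
  moreover have "\<forall>x\<in>?P. \<forall>y\<in>?P. ?le\<^sup>=\<^sup>= x y \<or> ?le\<^sup>=\<^sup>= y x"
    using right_path_chain[OF assms] by (simp add: pred_on.chain_def)
  ultimately have "pred_on.chain (?A (upper_end n)) ?le (C \<union> ?P)"
    using le_P unfolding pred_on.chain_def by blast
  from chain_length_le_poset_rank[OF fin this] show ?thesis
    using card rank \<open>0 < card C\<close> unfolding elem_rank_def by linarith
qed

text \<open>If \<open>[x, y]\<close> meets the other region, then \<open>x\<close> and
  \<open>y\<close> must be the two ends, and their rank difference exceeds \<open>d\<close>. Hence
  all of \<open>[x, y]\<close>, and with it any replacement \<open>D\<close>, stays on the
  right.\<close>

lemma chain_move_stays_right:
  assumes "4 \<le> n" "d < int (n - 2)"
    and "chain_move (crystal_le n [2, 2]) d C C'"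
    and C: "C \<subseteq> closed_interval (crystal_le n [2, 2]) (lower_end n) (upper_end n)"
      "C \<subseteq> right_side n \<union> {lower_end n, upper_end n}"
  shows "C' \<subseteq> closed_interval (crystal_le n [2, 2]) (lower_end n) (upper_end n)"
    and "C' \<subseteq> right_side n \<union> {lower_end n, upper_end n}"
proof -
  let ?le = "crystal_le n [2, 2]"
  let ?I = "closed_interval ?le (lower_end n) (upper_end n)"
  obtain x y D where xy: "x \<in> C" "y \<in> C" "?le x y" "x \<noteq> y"
      and rank: "int (elem_rank ?le y) - int (elem_rank ?le x) \<le> d"
      and D: "saturated_chain ?le x y D" and C': "C' = (C - closed_interval ?le x y) \<union> D"
    using assms(3) unfolding chain_move_def strict_less_def by blast
  have D_sub: "D \<subseteq> closed_interval ?le x y"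
    using D by (simp add: saturated_chain_def pred_on.maxchain_def pred_on.chain_def)
  have xyI: "x \<in> ?I" "y \<in> ?I"
    using xy C by auto
  then have sub_I: "closed_interval ?le x y \<subseteq> ?I"
    using crystal_le_trans[of n "[2, 2]"] unfolding closed_interval_def by blast
  then show "C' \<subseteq> ?I"
    using C(1) C' D_sub by blast
  have "z \<in> right_side n \<union> {lower_end n, upper_end n}" if z: "z \<in> closed_interval ?le x y" for z
  proof (rule ccontr)
    assume nz: "z \<notin> right_side n \<union> {lower_end n, upper_end n}"
    have zI: "z \<in> ?I" and le: "?le x z" "?le z y"
      using z sub_I by (auto simp: closed_interval_def)
    \<comment> \<open>Otherwise \<open>x\<close>, which is not the upper end because it lies
      strictly below \<open>y\<close>, is in \<open>right_side n\<close> and forces \<open>z\<close>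
      into it. The argument for \<open>y\<close> is dual.\<close>
    have "x = lower_end n"
    proof (rule ccontr)
      assume "x \<noteq> lower_end n"
      moreover have "x \<noteq> upper_end n"
        using xy(3,4) xyI(2) crystal_le_antisym_22[of n x y] by (auto simp: closed_interval_def)
      ultimately show False
        using comparable_same_side[OF assms(1) le(1) xyI(1) zI] nz C(2) xy(1) by auto
    qed
    moreover have "y = upper_end n"
    proof (rule ccontr)
      assume "y \<noteq> upper_end n"
      moreover have "y \<noteq> lower_end n"
        using xy(3,4) xyI(1) crystal_le_antisym_22[of n x y] by (auto simp: closed_interval_def)
      ultimately show False
        using comparable_same_side[OF assms(1) le(2) zI xyI(2)] nz C(2) xy(2) by auto
    qed
    ultimately show False
      using rank elem_rank_ends_diff[OF assms(1)] assms(2) by simp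
  qed
  then show "C' \<subseteq> right_side n \<union> {lower_end n, upper_end n}"
    using C(2) C' D_sub by blast
qed

lemma bounded_moves_do_not_connect:
  assumes "4 \<le> n" "d < int (n - 2)"
  shows "\<exists>C C'. pred_on.maxchain (closed_interval (crystal_le n [2, 2]) (lower_end n) (upper_end n)) (crystal_le n [2, 2]) C \<and>
    pred_on.maxchain (closed_interval (crystal_le n [2, 2]) (lower_end n) (upper_end n)) (crystal_le n [2, 2]) C' \<and>
    \<not> (chain_move (crystal_le n [2, 2]) d)\<^sup>*\<^sup>* C C'"
proof -
  let ?le = "crystal_le n [2, 2]"
  let ?I = "closed_interval ?le (lower_end n) (upper_end n)"
  let ?R = "right_side n \<union> {lower_end n, upper_end n}"
  define p where "p = corner_tab n 1 3"
  define q where "q = corner_tab n 2 2"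
  have "p \<in> open_interval ?le (lower_end n) (upper_end n)"
    unfolding p_def using assms(1) by (intro right_path_in_open_interval) auto
  then have p: "p \<in> ?I" "p \<noteq> lower_end n" "p \<noteq> upper_end n"
    by (auto simp: open_interval_def closed_interval_def strict_less_def)
  have q: "q \<in> ?I" "q \<notin> ?R"
    using left_point_in_open_interval[OF assms(1)]
    by (auto simp: q_def open_interval_def closed_interval_def strict_less_def right_side_def)
  have through: "\<exists>C. pred_on.maxchain ?I ?le C \<and> x \<in> C" if "x \<in> ?I" for x
    using chain_extends_to_maxchain[OF finite_crystal_interval, of n "lower_end n" "upper_end n" ?le "{x}"] that
    by (auto simp: pred_on.chain_def)
  obtain C where C: "pred_on.maxchain ?I ?le C" "p \<in> C"
    using through p(1) by blast
  obtain C' where C': "pred_on.maxchain ?I ?le C'" "q \<in> C'"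
    using through q(1) by blast
  have CI: "C \<subseteq> ?I" and comp: "\<And>x. x \<in> C \<Longrightarrow> ?le x p \<or> ?le p x \<or> x = p"
    using C by (auto simp: pred_on.maxchain_def pred_on.chain_def)
  have pR: "p \<in> right_side n"
    by (auto simp: p_def right_side_def)
  \<comment> \<open>Every element of \<open>C\<close> is comparable with \<open>p\<close>, so apart
    from the ends it is on the side of \<open>p\<close>.\<close>
  have CR: "C \<subseteq> ?R"
  proof
    fix x assume x: "x \<in> C"
    then have "x \<in> ?I" using CI by blast
    then show "x \<in> ?R"
      using comp[OF x] comparable_same_side[OF assms(1), of x p] comparable_same_side[OF assms(1), of p x] p pR
      by blast
  qed
  \<comment> \<open>Lying in \<open>?I\<close> and \<open>?R\<close> is preserved by moves, but
    \<open>C'\<close> contains \<open>q\<close> outside \<open>?R\<close>.\<close>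
  have "D \<subseteq> ?I \<and> D \<subseteq> ?R" if "(chain_move ?le d)\<^sup>*\<^sup>* C D" for D
    using that
  proof (induction rule: rtranclp_induct)
    case (step D E)
    then show ?case
      using chain_move_stays_right[OF assms step.hyps(2)] by blast
  qed (use CI CR in blast)
  then have "\<not> (chain_move ?le d)\<^sup>*\<^sup>* C C'"
    using C'(2) q(2) by blast
  then show ?thesis using C(1) C'(1) by blast
qed

theorem theorem7p1:
  "(\<not> (\<exists>d::int. \<forall>n lam u v C C'.
        is_partition lam \<longrightarrow> length lam < n \<longrightarrow> crystal_le n lam u v \<longrightarrow>
        pred_on.maxchain (closed_interval (crystal_le n lam) u v) (crystal_le n lam) C \<longrightarrow>
        pred_on.maxchain (closed_interval (crystal_le n lam) u v) (crystal_le n lam) C' \<longrightarrow>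
        (chain_move (crystal_le n lam) d)\<^sup>*\<^sup>* C C')) \<and>
   (\<forall>N::nat. \<exists>n lam u v.
        is_partition lam \<and> length lam < n \<and> crystal_le n lam u v \<and>
        N \<le> poset_rank (crystal_le n lam) (open_interval (crystal_le n lam) u v) \<and>
        hasse_disconnected (crystal_le n lam) (open_interval (crystal_le n lam) u v))"
proof -
  have part: "is_partition [2, 2]" by (simp add: is_partition_def)
  have ends: "crystal_le n [2, 2] (lower_end n) (upper_end n)" if "4 \<le> n" for n
    unfolding lower_end_def using that by (intro right_path_end) auto
  show ?thesis
  proof (intro conjI notI allI)
    assume "\<exists>d::int. \<forall>n lam u v C C'.
        is_partition lam \<longrightarrow> length lam < n \<longrightarrow> crystal_le n lam u v \<longrightarrow>
        pred_on.maxchain (closed_interval (crystal_le n lam) u v) (crystal_le n lam) C \<longrightarrow>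
        pred_on.maxchain (closed_interval (crystal_le n lam) u v) (crystal_le n lam) C' \<longrightarrow>
        (chain_move (crystal_le n lam) d)\<^sup>*\<^sup>* C C'"
    then obtain d :: int where d: "\<And>n lam u v C C'.
        is_partition lam \<Longrightarrow> length lam < n \<Longrightarrow> crystal_le n lam u v \<Longrightarrow>
        pred_on.maxchain (closed_interval (crystal_le n lam) u v) (crystal_le n lam) C \<Longrightarrow>
        pred_on.maxchain (closed_interval (crystal_le n lam) u v) (crystal_le n lam) C' \<Longrightarrow>
        (chain_move (crystal_le n lam) d)\<^sup>*\<^sup>* C C'"
      by blast
    \<comment> \<open>The summand 4 gives \<open>4 \<le> n\<close> also for negative
      \<open>d\<close>, where \<open>nat d = 0\<close>, and leaves \<open>n - 2 = nat d + 2\<close>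
      above \<open>d\<close>.\<close>
    define n where "n = nat d + 4"
    have n: "4 \<le> n" "d < int (n - 2)" by (auto simp: n_def)
    then show False
      using bounded_moves_do_not_connect[OF n] d[OF part _ ends[OF n(1)]] by auto
  next
    fix N :: nat
    \<comment> \<open>With \<open>n = N + 4\<close>, the rank of the open interval is at least
      \<open>n - 3 = N + 1\<close>.\<close>
    have "4 \<le> N + 4" by simp
    then show "\<exists>n lam u v. is_partition lam \<and> length lam < n \<and> crystal_le n lam u v \<and>
        N \<le> poset_rank (crystal_le n lam) (open_interval (crystal_le n lam) u v) \<and>
        hasse_disconnected (crystal_le n lam) (open_interval (crystal_le n lam) u v)"
      using part ends[of "N + 4"] open_interval_rank[of "N + 4"] open_interval_disconnected[of "N + 4"]
      by (intro exI[of _ "N + 4"] exI[of _ "[2, 2]"] exI[of _ "lower_end (N + 4)"] exI[of _ "upper_end (N + 4)"]) auto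
  qed
qed

end
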